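(* Let $\alpha,\beta\in\mathcal{OCT}_n$ be such that $\alpha=\begin{pmatrix} A_1 & A_2\\ x+1 & x+2\end{pmatrix}$, i.e. $\alpha$ has image $\{x+1,x+2\}$ and kernel classes $A_1<A_2$ with $A_1\alpha=\{x+1\}$, $A_2\alpha=\{x+2\}$. Then $\alpha\le\beta$ if and only if $\operatorname{im}\alpha\subseteq\operatorname{im}\beta$, $(\max A_1)\beta=x+1$ and $(\min A_2)\beta=x+2$.
   Context: $[n]=\{1,2,\ldots,n\}$ with its usual order. Maps are written on the right of their arguments. $\mathcal{OCT}_n$ is the semigroup (under composition, $x(\alpha\beta)=(x\alpha)\beta$) of all maps $\alpha:[n]\to[n]$ that are contractions ($|x\alpha-y\alpha|\le|x-y|$ for all $x,y\in[n]$) and order-preserving ($x\le y\Rightarrow x\alpha\le y\alpha$). The kernel classes of $\alpha$ are the equivalence classes of $\{(u,v): u\alpha=v\alpha\}$; $A<B$ means every element of $A$ is less than every element of $B$. $\operatorname{im}$ denotes image; $x\ge0$ is an integer. The natural partial order on a semigroup $S$: $\alpha\le\beta$ iff there exist $\lambda,\mu\in S^1$ with $\alpha=\lambda\beta=\beta\mu$ and $\alpha=\alpha\mu$; here $S=\mathcal{OCT}_n$. *)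

theory Defs
  imports Main "HOL-Library.FuncSet"
begin

text \<open>
  A semigroup is given by a carrier \<open>S\<close> and a multiplication \<open>m\<close>.
  The monoid \<open>S\<^sup>1\<close> lives in the option type: \<open>None\<close> is the adjoined identity, which is
  present only if \<open>S\<close> has no identity of its own.
\<close>

definition adjoin_one :: "'a set \<Rightarrow> ('a \<Rightarrow> 'a \<Rightarrow> 'a) \<Rightarrow> 'a option set" where
  "adjoin_one S m =
     (if \<exists>e\<in>S. \<forall>s\<in>S. m e s = s \<and> m s e = s then Some ` S else insert None (Some ` S))"

fun mult_one :: "('a \<Rightarrow> 'a \<Rightarrow> 'a) \<Rightarrow> 'a option \<Rightarrow> 'a option \<Rightarrow> 'a option" where
  "mult_one m None t = t"
| "mult_one m (Some a) None = Some a"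
| "mult_one m (Some a) (Some b) = Some (m a b)"

definition natural_le :: "'a set \<Rightarrow> ('a \<Rightarrow> 'a \<Rightarrow> 'a) \<Rightarrow> 'a \<Rightarrow> 'a \<Rightarrow> bool" where
  "natural_le S m a b \<longleftrightarrow>
     (\<exists>l \<in> adjoin_one S m. \<exists>r \<in> adjoin_one S m.
        Some a = mult_one m l (Some b) \<and>
        Some a = mult_one m (Some b) r \<and>
        Some a = mult_one m (Some a) r)"

text \<open>
  Maps \<open>[n] \<rightarrow> [n]\<close> are extensional functions on \<open>{1..n}\<close>, so that equality of functions is
  equality of maps on \<open>[n]\<close>.
\<close>

definition contraction :: "nat \<Rightarrow> (nat \<Rightarrow> nat) \<Rightarrow> bool" where
  "contraction n f \<longleftrightarrow>
     (\<forall>x\<in>{1..n}. \<forall>y\<in>{1..n}. \<bar>int (f x) - int (f y)\<bar> \<le> \<bar>int x - int y\<bar>)"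

definition OCT :: "nat \<Rightarrow> (nat \<Rightarrow> nat) set" where
  "OCT n = {f \<in> {1..n} \<rightarrow>\<^sub>E {1..n}. contraction n f \<and> mono_on {1..n} f}"

text \<open>
  Maps act on the right: in the product of \<open>f\<close> and \<open>g\<close>, \<open>f\<close> is applied first.
\<close>

definition rcomp :: "nat \<Rightarrow> (nat \<Rightarrow> nat) \<Rightarrow> (nat \<Rightarrow> nat) \<Rightarrow> nat \<Rightarrow> nat" where
  "rcomp n f g = compose {1..n} g f"

definition OCT_le :: "nat \<Rightarrow> (nat \<Rightarrow> nat) \<Rightarrow> (nat \<Rightarrow> nat) \<Rightarrow> bool" where
  "OCT_le n = natural_le (OCT n) (rcomp n)"

definition ker_rel :: "nat \<Rightarrow> (nat \<Rightarrow> nat) \<Rightarrow> (nat \<times> nat) set" where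
  "ker_rel n f = {(u, v). u \<in> {1..n} \<and> v \<in> {1..n} \<and> f u = f v}"

definition set_less :: "nat set \<Rightarrow> nat set \<Rightarrow> bool" where
  "set_less A B \<longleftrightarrow> (\<forall>a\<in>A. \<forall>b\<in>B. a < b)"

end

theory Submission
  imports Defs
begin

text \<open>
  A map in \<open>OCT n\<close> with image \<open>{c, c + 1}\<close> is a single step: it is \<open>c\<close> up to some point \<open>k\<close> and
  \<open>c + 1\<close> beyond it, where \<open>k = max A\<^sub>1\<close> and \<open>k + 1 = min A\<^sub>2\<close>. So the question is when a step \<open>\<alpha>\<close>
  at \<open>k\<close> lies below \<open>\<beta>\<close>. As \<open>OCT n\<close> is a monoid, \<open>\<alpha> \<le> \<beta>\<close> asks for \<open>\<lambda>\<close> and \<open>\<mu>\<close> in \<open>OCT n\<close>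
  itself with \<open>\<alpha> = \<lambda>\<beta> = \<beta>\<mu> = \<alpha>\<mu>\<close>.

  If such maps exist, then \<open>\<mu>\<close> fixes \<open>c\<close> and \<open>c + 1\<close>, the two values of \<open>\<alpha>\<close>, and sends \<open>k\<beta>\<close> to
  \<open>c\<close> and \<open>(k + 1)\<beta>\<close> to \<open>c + 1\<close>. As \<open>\<mu>\<close> preserves the order, \<open>k\<beta> \<le> c\<close> and \<open>c + 1 \<le> (k + 1)\<beta>\<close>.
  But \<open>\<beta>\<close> is a contraction, so \<open>k\<beta>\<close> and \<open>(k + 1)\<beta>\<close> are at most \<open>1\<close> apart and both inequalities
  are equalities. Conversely, if \<open>k\<beta> = c\<close> and \<open>(k + 1)\<beta> = c + 1\<close>, one may take for \<open>\<lambda>\<close> the step at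
  \<open>k\<close> with values \<open>k, k + 1\<close> and for \<open>\<mu>\<close> the step at \<open>c\<close> with values \<open>c, c + 1\<close>. The
  inclusion \<open>im \<alpha> \<subseteq> im \<beta>\<close> follows from these two values of \<open>\<beta>\<close>.
\<close>

lemma natural_le_monoid:
  assumes "e \<in> S" and "\<And>s. s \<in> S \<Longrightarrow> m e s = s \<and> m s e = s"
  shows "natural_le S m a b \<longleftrightarrow> (\<exists>l\<in>S. \<exists>r\<in>S. a = m l b \<and> a = m b r \<and> a = m a r)"
proof -
  have "adjoin_one S m = Some ` S"
    using assms by (auto simp: adjoin_one_def)
  then show ?thesis by (auto simp: natural_le_def)
qed

lemma OCT_I:
  assumes "f \<in> {1..n} \<rightarrow>\<^sub>E {1..n}"
    and "\<And>i j. \<lbrakk>i \<in> {1..n}; j \<in> {1..n}; i \<le> j\<rbrakk> \<Longrightarrow> f i \<le> f j \<and> f j + i \<le> f i + j"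
  shows "f \<in> OCT n"
proof -
  have "\<bar>int (f i) - int (f j)\<bar> \<le> \<bar>int i - int j\<bar>" if "i \<in> {1..n}" "j \<in> {1..n}" for i j
    using assms(2)[of i j] assms(2)[of j i] that by (cases "i \<le> j") auto
  moreover have "mono_on {1..n} f"
    using assms(2) by (intro mono_onI) auto
  ultimately show ?thesis
    using assms(1) by (simp add: OCT_def contraction_def)
qed

lemma OCT_range: "f \<in> OCT n \<Longrightarrow> i \<in> {1..n} \<Longrightarrow> f i \<in> {1..n}"
  by (auto simp: OCT_def)

lemma OCT_outside: "f \<in> OCT n \<Longrightarrow> i \<notin> {1..n} \<Longrightarrow> f i = undefined"
  by (auto simp: OCT_def PiE_def extensional_def)

lemma OCT_mono: "f \<in> OCT n \<Longrightarrow> i \<in> {1..n} \<Longrightarrow> j \<in> {1..n} \<Longrightarrow> i \<le> j \<Longrightarrow> f i \<le> f j"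
  by (auto simp: OCT_def mono_on_def)

lemma OCT_Suc_le:
  assumes "f \<in> OCT n" "i \<in> {1..n}" "i + 1 \<in> {1..n}"
  shows "f (i + 1) \<le> f i + 1"
proof -
  have "\<bar>int (f (i + 1)) - int (f i)\<bar> \<le> \<bar>int (i + 1) - int i\<bar>"
    using assms unfolding OCT_def contraction_def by blast
  then show ?thesis by linarith
qed

lemma rcomp_apply: "i \<in> {1..n} \<Longrightarrow> rcomp n f g i = g (f i)"
  by (simp add: rcomp_def compose_def)

lemma rcomp_outside: "i \<notin> {1..n} \<Longrightarrow> rcomp n f g i = undefined"
  by (simp only: rcomp_def compose_def restrict_apply if_False)

lemma OCT_le_iff:
  "OCT_le n \<alpha> \<beta> \<longleftrightarrow>
    (\<exists>l\<in>OCT n. \<exists>r\<in>OCT n. \<alpha> = rcomp n l \<beta> \<and> \<alpha> = rcomp n \<beta> r \<and> \<alpha> = rcomp n \<alpha> r)"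
proof -
  let ?e = "\<lambda>i\<in>{1..n}. i"
  have "?e \<in> OCT n"
    by (rule OCT_I) auto
  moreover have "rcomp n ?e s = s \<and> rcomp n s ?e = s" if "s \<in> OCT n" for s
  proof -
    have "rcomp n ?e s i = s i \<and> rcomp n s ?e i = s i" for i
      using OCT_range[OF that, of i] OCT_outside[OF that, of i]
      by (cases "i \<in> {1..n}") (simp_all add: rcomp_apply rcomp_outside)
    then show ?thesis by blast
  qed
  ultimately show ?thesis
    unfolding OCT_le_def by (rule natural_le_monoid)
qed

definition step_map :: "nat \<Rightarrow> nat \<Rightarrow> nat \<Rightarrow> nat \<Rightarrow> nat" where
  "step_map n k c = (\<lambda>i\<in>{1..n}. if i \<le> k then c else c + 1)"

lemma step_map_outside: "i \<notin> {1..n} \<Longrightarrow> step_map n k c i = undefined"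
  by (simp only: step_map_def restrict_apply if_False)

lemma step_map_in_OCT: "1 \<le> c \<Longrightarrow> c < n \<Longrightarrow> step_map n k c \<in> OCT n"
  by (rule OCT_I) (auto simp: step_map_def)

lemma rcomp_step_map_left:
  assumes "\<beta> c = d" "\<beta> (c + 1) = d + 1"
  shows "rcomp n (step_map n k c) \<beta> = step_map n k d"
proof
  show "rcomp n (step_map n k c) \<beta> i = step_map n k d i" for i
    using assms by (cases "i \<in> {1..n}")
      (simp_all add: rcomp_apply rcomp_outside step_map_outside, simp add: step_map_def)
qed

text \<open>
  An order-preserving map passing from \<open>d\<close> to \<open>d + 1\<close> between \<open>k\<close> and \<open>k + 1\<close> has
  \<open>{1..k}\<close> as its preimage of \<open>{1..d}\<close>.
\<close>

lemma rcomp_step_map_right: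
  assumes \<beta>: "\<beta> \<in> OCT n" and k: "1 \<le> k" "k < n" and d: "\<beta> k = d" "\<beta> (k + 1) = d + 1"
  shows "rcomp n \<beta> (step_map n d c) = step_map n k c"
proof
  fix i
  show "rcomp n \<beta> (step_map n d c) i = step_map n k c i"
  proof (cases "i \<in> {1..n}")
    case True
    have "\<beta> i \<le> d \<longleftrightarrow> i \<le> k"
    proof (cases "i \<le> k")
      case True
      then show ?thesis
        using OCT_mono[OF \<beta>, of i k] \<open>i \<in> {1..n}\<close> k d by simp
    next
      case False
      then show ?thesis
        using OCT_mono[OF \<beta>, of "k + 1" i] \<open>i \<in> {1..n}\<close> k d by simp
    qed
    then show ?thesis
      using True OCT_range[OF \<beta> True] by (simp add: rcomp_apply step_map_def)
  qed (simp add: rcomp_outside step_map_outside)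
qed

text \<open>
  Necessity comes from the right multiplier \<open>r\<close>: as it fixes \<open>c\<close> and \<open>c + 1\<close> and preserves
  the order, \<open>r (\<beta> k) = c\<close> forbids \<open>\<beta> k > c\<close> and \<open>r (\<beta> (k + 1)) = c + 1\<close> forbids
  \<open>\<beta> (k + 1) \<le> c\<close>; the contraction \<open>\<beta>\<close> then has no other choice. For sufficiency, steps serve as multipliers on both sides.
\<close>

lemma step_map_le_iff:
  assumes \<beta>: "\<beta> \<in> OCT n" and k: "1 \<le> k" "k < n" and c: "1 \<le> c" "c < n"
  shows "OCT_le n (step_map n k c) \<beta> \<longleftrightarrow> \<beta> k = c \<and> \<beta> (k + 1) = c + 1"
proof
  let ?\<alpha> = "step_map n k c"
  assume "OCT_le n ?\<alpha> \<beta>"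
  then obtain r where r: "r \<in> OCT n" and \<beta>r: "?\<alpha> = rcomp n \<beta> r" and \<alpha>r: "?\<alpha> = rcomp n ?\<alpha> r"
    unfolding OCT_le_iff by blast
  have \<alpha>_vals: "?\<alpha> k = c" "?\<alpha> (k + 1) = c + 1"
    using k by (simp_all add: step_map_def)
  have r_fix: "r c = c" "r (c + 1) = c + 1"
    using fun_cong[OF \<alpha>r, of k] fun_cong[OF \<alpha>r, of "k + 1"] k \<alpha>_vals
    by (simp_all add: rcomp_apply)
  have r_\<beta>: "r (\<beta> k) = c" "r (\<beta> (k + 1)) = c + 1"
    using fun_cong[OF \<beta>r, of k] fun_cong[OF \<beta>r, of "k + 1"] k \<alpha>_vals
    by (simp_all add: rcomp_apply)
  have \<beta>_range: "\<beta> k \<in> {1..n}" "\<beta> (k + 1) \<in> {1..n}"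
    using OCT_range[OF \<beta>] k by simp_all
  have "\<not> c + 1 \<le> \<beta> k"
    using OCT_mono[OF r, of "c + 1" "\<beta> k"] r_fix r_\<beta> \<beta>_range c by auto
  moreover have "\<not> \<beta> (k + 1) \<le> c"
    using OCT_mono[OF r, of "\<beta> (k + 1)" c] r_fix r_\<beta> \<beta>_range c by auto
  moreover have "\<beta> (k + 1) \<le> \<beta> k + 1"
    using OCT_Suc_le[OF \<beta>, of k] k by simp
  ultimately show "\<beta> k = c \<and> \<beta> (k + 1) = c + 1" by linarith
next
  assume \<beta>_vals: "\<beta> k = c \<and> \<beta> (k + 1) = c + 1"
  let ?\<alpha> = "step_map n k c" and ?l = "step_map n k k" and ?r = "step_map n c c"
  have "?\<alpha> = rcomp n ?l \<beta>"
    using rcomp_step_map_left[of \<beta> k c] \<beta>_vals by simp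
  moreover have "?\<alpha> = rcomp n \<beta> ?r"
    using rcomp_step_map_right[OF \<beta> k] \<beta>_vals by simp
  moreover have "?\<alpha> = rcomp n ?\<alpha> ?r"
    using rcomp_step_map_left[of ?r c c n k] c by (simp add: step_map_def)
  ultimately show "OCT_le n ?\<alpha> \<beta>"
    unfolding OCT_le_iff using step_map_in_OCT k c by blast
qed

lemma kernel_class_eq_fibre:
  assumes "A \<in> {1..n} // ker_rel n f" "f ` A = {c}"
  shows "A = {i \<in> {1..n}. f i = c}"
proof -
  from assms(1) obtain u where u: "u \<in> {1..n}" and A: "A = ker_rel n f `` {u}"
    by (rule quotientE)
  have A': "A = {i \<in> {1..n}. f i = f u}"
    using u A by (auto simp: ker_rel_def)
  then have "f u = c"
    using u assms(2) by auto
  then show ?thesis using A' by simp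
qed

text \<open>
  The two fibres fill \<open>{1..n}\<close> and the lower one lies entirely to the left, so nothing fits between
  its maximum and the minimum of the other.
\<close>

lemma two_valued_is_step_map:
  assumes ext: "f \<in> extensional {1..n}"
    and img: "f ` {1..n} = {c, c + 1}"
    and A1: "A1 = {i \<in> {1..n}. f i = c}" and A2: "A2 = {i \<in> {1..n}. f i = c + 1}"
    and less: "set_less A1 A2"
  obtains k where "Max A1 = k" "Min A2 = k + 1" "1 \<le> k" "k < n" "f = step_map n k c"
proof -
  define k where "k = Max A1"
  have fin: "finite A1" "finite A2"
    using A1 A2 by auto
  have "c \<in> f ` {1..n}" "c + 1 \<in> f ` {1..n}"
    using img by auto
  then have ne: "A1 \<noteq> {}" "A2 \<noteq> {}"
    using A1 A2 by auto
  have cover: "i \<in> A1 \<or> i \<in> A2" if "i \<in> {1..n}" for i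
    using that img A1 A2 by blast
  have k: "k \<in> A1" and k_max: "\<And>i. i \<in> A1 \<Longrightarrow> i \<le> k"
    using fin ne by (simp_all add: k_def)
  have A2_gt: "k < i" if "i \<in> A2" for i
    using k less that by (auto simp: set_less_def)
  obtain j where j: "j \<in> A2"
    using ne by blast
  have kn: "1 \<le> k" "k < n"
    using k j A2_gt[OF j] A1 A2 by auto
  have "k + 1 \<in> A2"
    using cover[of "k + 1"] k_max[of "k + 1"] kn by auto
  then have "Min A2 = k + 1"
    using fin A2_gt by (intro Min_eqI) (auto simp: Suc_le_eq)
  moreover have "f = step_map n k c"
  proof
    fix i
    show "f i = step_map n k c i"
    proof (cases "i \<in> {1..n}")
      case True
      then show ?thesis
        using cover[OF True] k_max[of i] A2_gt[of i] A1 A2 by (auto simp: step_map_def)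
    next
      case False
      then show ?thesis
        using extensional_arb[OF ext False] by (simp add: step_map_outside)
    qed
  qed
  ultimately show thesis
    using that k_def kn by blast
qed

theorem lemma25:
  fixes n x :: nat and \<alpha> \<beta> :: "nat \<Rightarrow> nat" and A1 A2 :: "nat set"
  assumes "\<alpha> \<in> OCT n" and "\<beta> \<in> OCT n"
    and "\<alpha> ` {1..n} = {x + 1, x + 2}"
    and "{1..n} // ker_rel n \<alpha> = {A1, A2}"
    and "set_less A1 A2"
    and "\<alpha> ` A1 = {x + 1}" and "\<alpha> ` A2 = {x + 2}"
  shows "OCT_le n \<alpha> \<beta> \<longleftrightarrow>
    \<alpha> ` {1..n} \<subseteq> \<beta> ` {1..n} \<and> \<beta> (Max A1) = x + 1 \<and> \<beta> (Min A2) = x + 2"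
proof -
  have ext: "\<alpha> \<in> extensional {1..n}"
    using assms(1) unfolding OCT_def PiE_def by blast
  have img: "\<alpha> ` {1..n} = {x + 1, x + 1 + 1}"
    using assms(3) by simp
  have A1: "A1 = {i \<in> {1..n}. \<alpha> i = x + 1}"
    using kernel_class_eq_fibre[of A1 n \<alpha>] assms(4,6) by blast
  have A2: "A2 = {i \<in> {1..n}. \<alpha> i = x + 1 + 1}"
    using kernel_class_eq_fibre[of A2 n \<alpha> "x + 2"] assms(4,7) by simp
  obtain k where k: "Max A1 = k" "Min A2 = k + 1" "1 \<le> k" "k < n"
      and step: "\<alpha> = step_map n k (x + 1)"
    by (rule two_valued_is_step_map[OF ext img A1 A2 assms(5)])
  have "x + 2 \<in> \<alpha> ` {1..n}"
    using assms(3) by simp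
  then have "x + 1 < n"
    using OCT_range[OF assms(1)] by fastforce
  then have le_iff: "OCT_le n \<alpha> \<beta> \<longleftrightarrow> \<beta> k = x + 1 \<and> \<beta> (k + 1) = x + 2"
    using step_map_le_iff[OF assms(2) k(3,4), of "x + 1"] by (simp add: step)
  have "{x + 1, x + 2} \<subseteq> \<beta> ` {1..n}" if "\<beta> k = x + 1" "\<beta> (k + 1) = x + 2"
    using that k(3,4) image_eqI[of "x + 1" \<beta> k] image_eqI[of "x + 2" \<beta> "k + 1"] by simp
  then show ?thesis
    unfolding le_iff k(1,2) assms(3) by blast
qed

end
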